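(* Let $0<\sigma_1<1$ and $0<\sigma_2<1$. Then for every $x>0$, $$\phi(-\sigma_1\sigma_2,0;-x)=\int_0^\infty\phi(-\sigma_1,0;-s)\,\phi(-\sigma_2,0;-xs^{-\sigma_2})\,\frac{ds}{s}.$$
   Context: For real $\rho\in(-1,0)\cup(0,\infty)$ and real $z$, the reduced Wright function is $\phi(\rho,0;z)=\sum_{n=1}^\infty \frac{z^n}{n!\,\Gamma(\rho n)}$, where $1/\Gamma$ is the entire reciprocal gamma function (equal to $0$ at $0,-1,-2,\ldots$). *)

theory Defs
  imports "HOL-Analysis.Analysis"
begin

(* The series converges for all real z when \<rho> > -1; the sum starts at n = 1, hence the Suc n.
   rGamma is the entire reciprocal Gamma function, so terms at poles of Gamma vanish. *)
definition reduced_wright :: "real \<Rightarrow> real \<Rightarrow> real" where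
  "reduced_wright \<rho> z =
     (\<Sum>n. z ^ Suc n / fact (Suc n) * rGamma (\<rho> * real (Suc n)))"

end

(* Rotating Hankel's contour to the rays of angle +-theta with pi/2 < theta < pi turns the series into
   phi(-sigma, 0; -y) = (1/pi) Im of the integral over r > 0 of
     e^{i theta} exp(r e^{i theta} - y r^sigma e^{i sigma theta}).
   As theta tends to pi/2, this exhibits F(s) = phi(-sigma, 0; -x s^(-sigma)) / s as a Fourier integral, and
   Cauchy's formula in the right half-plane gives its Laplace transform exp(-x p^sigma).
   Inserting the ray integral for sigma1 under the integral over s and applying Fubini, the inner
   integral is the Laplace transform of F for sigma2 at p = u^sigma1, u = r e^{i theta}; its value
   exp(-x u^(sigma1 sigma2)) is the integrand of the ray integral for sigma1 sigma2. The angle is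
   chosen with sigma1 theta < pi/2 so that Re p > 0. *)
theory Submission
  imports Defs "HOL-Complex_Analysis.Complex_Analysis" "HOL-Real_Asymp.Real_Asymp"
begin

subsection \<open>Integrals over the positive half-line\<close>

text \<open>The obstacle is absolute convergence, and it is why two angles occur. Expanding exp (- y
  u^\<sigma>) term by term costs the majorant exp (|y| r^\<sigma>). Only the decay exp (r cos
  \<theta>) with \<theta> > pi/2 absorbs it, and only because \<sigma> < 1. At \<theta> = pi/2 that
  decay is gone and convergence rests on Re u^\<sigma> > 0 instead, so the imaginary axis is reached
  as a limit of rays and not from the series. It is worth reaching: the contour can be closed in the
  right half-plane, up to whose boundary the power is continuous, and the kernel exp (i t y) has
  modulus 1 for every t. In the final exchange of integrals the ray is tilted again, which bounds
  its kernel by exp (r cos \<theta>) uniformly in s; integrability in s must then come from F alone,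
  which is why F is estimated at both ends of the half-line.\<close>

text \<open>A measure on all reals instead of a restricted space: measurability stays plain Borel
  measurability, product measures apply directly, and almost-everywhere claims need checking only
  for r > 0.\<close>

definition halfline :: "real measure" where
  "halfline = density lborel (\<lambda>r. ennreal (indicator {0<..} r))"

lemma sets_halfline [simp, measurable_cong]: "sets halfline = sets borel"
  by (simp add: halfline_def)

lemma space_halfline [simp]: "space halfline = UNIV"
  by (simp add: halfline_def)

lemma AE_halflineI:
  assumes "\<And>r. r > 0 \<Longrightarrow> P r"
  shows "AE r in halfline. P r"
  unfolding halfline_def by (subst AE_density) (auto intro!: AE_I2 assms simp: indicator_def)

lemma sigma_finite_halfline: "sigma_finite_measure halfline"
  unfolding halfline_def
  by (subst sigma_finite_measure.sigma_finite_iff_density_finite[OF sigma_finite_lborel])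
     auto

interpretation halfline: sigma_finite_measure halfline
  by (rule sigma_finite_halfline)

lemma integrable_halfline_iff:
  fixes f :: "real \<Rightarrow> 'a::{banach, second_countable_topology}"
  assumes "f \<in> borel_measurable borel"
  shows "integrable halfline f \<longleftrightarrow> set_integrable lborel {0<..} f"
  unfolding halfline_def set_integrable_def using assms
  by (subst integrable_density) auto

lemma integral_halfline:
  fixes f :: "real \<Rightarrow> 'a::{banach, second_countable_topology}"
  assumes "f \<in> borel_measurable borel"
  shows "integral\<^sup>L halfline f = (LINT r:{0<..}|lborel. f r)"
  unfolding halfline_def set_lebesgue_integral_def using assms
  by (subst integral_density) auto

lemma integral_halfline_scale:
  fixes f :: "real \<Rightarrow> 'a::{banach, second_countable_topology}"
  assumes [measurable]: "f \<in> borel_measurable borel" and c: "c > 0"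
  shows "integral\<^sup>L halfline f = c *\<^sub>R integral\<^sup>L halfline (\<lambda>r. f (c * r))"
proof -
  have *: "indicator {0<..} (c * r) = (indicator {0<..} r :: real)" for r
    using c by (auto simp: indicator_def zero_less_mult_iff)
  show ?thesis
    using lborel_integral_real_affine[of c "\<lambda>r. indicator {0<..} r *\<^sub>R f r" 0] c
    by (simp add: integral_halfline set_lebesgue_integral_def *)
qed

text \<open>A gauge integral of a nonnegative function converges absolutely. This transfers Euler's
  Gamma integral to the Lebesgue setting.\<close>

lemma has_integral_halfline_nonneg:
  fixes f :: "real \<Rightarrow> real"
  assumes [measurable]: "f \<in> borel_measurable borel"
    and nn: "\<And>r. r > 0 \<Longrightarrow> f r \<ge> 0"
    and int: "(f has_integral I) {0<..}"
  shows "integrable halfline f" "integral\<^sup>L halfline f = I"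
proof -
  have "set_integrable lebesgue {0<..} f"
    using int nn by (intro nonnegative_absolutely_integrable_1) auto
  then have si: "set_integrable lborel {0<..} f"
    unfolding set_integrable_def by (subst (asm) integrable_completion) auto
  then show "integrable halfline f" by (simp add: integrable_halfline_iff)
  show "integral\<^sup>L halfline f = I"
    using set_borel_integral_eq_integral(2)[OF si] int
    by (simp add: integral_halfline integral_unique)
qed

lemma integrable_halfline_bound:
  fixes f :: "real \<Rightarrow> 'a::{banach, second_countable_topology}"
  assumes g: "integrable halfline g" and [measurable]: "f \<in> borel_measurable borel"
    and le: "\<And>r. r > 0 \<Longrightarrow> norm (f r) \<le> g r"
  shows "integrable halfline f"
proof (rule Bochner_Integration.integrable_bound[OF g])
  show "AE r in halfline. norm (f r) \<le> norm (g r)"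
    using le by (intro AE_halflineI) (smt (verit) real_norm_def)
qed simp

lemma Gamma_halfline:
  fixes a A :: real
  assumes a: "a > 0" and A: "A > 0"
  shows "integrable halfline (\<lambda>r. r powr (a - 1) * exp (- A * r))"
    and "integral\<^sup>L halfline (\<lambda>r. r powr (a - 1) * exp (- A * r)) = Gamma a * A powr - a"
proof -
  have "((\<lambda>t. t powr (a - 1) * exp (-t)) has_integral Gamma a) {0..}"
    using Gamma_integral_real[OF a] by (simp add: exp_minus field_simps)
  then have H: "((\<lambda>t. t powr (a - 1) * exp (-t)) has_integral Gamma a) {0<..}"
    by (subst has_integral_spike_set_eq[of _ "{0..}"]) (auto intro: negligible_subset[of "{0::real}"])
  have 1: "integrable halfline (\<lambda>t. t powr (a - 1) * exp (-t))"
    "integral\<^sup>L halfline (\<lambda>t. t powr (a - 1) * exp (-t)) = Gamma a"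
    by (rule has_integral_halfline_nonneg[OF _ _ H]; simp)+
  have eq: "(A * r) powr (a - 1) * exp (- (A * r)) = A powr (a - 1) * (r powr (a - 1) * exp (- A * r))"
    if "r > 0" for r using A that by (simp add: powr_mult)
  have ind: "indicator {0<..} (A * r) = (indicator {0<..} r :: real)" for r
    using A by (auto simp: indicator_def zero_less_mult_iff)
  have "integrable lborel (\<lambda>r. indicator {0<..} r * (r powr (a - 1) * exp (- r)))"
    using 1(1) by (simp add: integrable_halfline_iff set_integrable_def)
  then have "integrable lborel (\<lambda>r. indicator {0<..} r * ((A * r) powr (a - 1) * exp (- (A * r))))"
    using lborel_integrable_real_affine[of "\<lambda>r. indicator {0<..} r * (r powr (a - 1) * exp (- r))" A 0] A
    by (simp add: ind)
  also have "(\<lambda>r. indicator {0<..} r * ((A * r) powr (a - 1) * exp (- (A * r)))) =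
      (\<lambda>r. A powr (a - 1) * (indicator {0<..} r * (r powr (a - 1) * exp (- A * r))))"
    using eq by (auto simp: indicator_def fun_eq_iff)
  finally have "integrable lborel (\<lambda>r. (indicator {0<..} r * (r powr (a - 1) * exp (- A * r))))"
    using A by simp
  then show "integrable halfline (\<lambda>r. r powr (a - 1) * exp (- A * r))"
    by (simp add: integrable_halfline_iff set_integrable_def)
  have "Gamma a = A * integral\<^sup>L halfline (\<lambda>r. (A * r) powr (a - 1) * exp (- (A * r)))"
    using integral_halfline_scale[of "\<lambda>t. t powr (a - 1) * exp (-t)", OF _ A] 1(2) by simp
  also have "integral\<^sup>L halfline (\<lambda>r. (A * r) powr (a - 1) * exp (- (A * r))) =
     integral\<^sup>L halfline (\<lambda>r. A powr (a - 1) * (r powr (a - 1) * exp (- A * r)))"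
    using eq by (intro integral_cong_AE AE_halflineI) auto
  also have "A * \<dots> = A powr a * integral\<^sup>L halfline (\<lambda>r. r powr (a - 1) * exp (- A * r))"
    using A by (subst integral_mult_right_zero) (simp add: powr_mult_base mult.assoc [symmetric])
  finally show "integral\<^sup>L halfline (\<lambda>r. r powr (a - 1) * exp (- A * r)) = Gamma a * A powr - a"
    using A by (simp add: powr_minus field_simps)
qed

lemma integrable_halfline_exp:
  assumes "A > 0"
  shows "integrable halfline (\<lambda>r. exp (- A * r))"
  by (rule integrable_halfline_bound[OF Gamma_halfline(1)[of 1 A]]) (use assms in auto)

text \<open>Serves both for exp (- b r^\<sigma>) and for the density, whose tail decays only like a
  power.\<close>

lemma integrable_halfline_powr_tail:
  fixes f :: "real \<Rightarrow> 'a::{banach, second_countable_topology}"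
  assumes [measurable]: "f \<in> borel_measurable borel" and q: "q > 1"
    and le1: "\<And>r. 0 < r \<Longrightarrow> r \<le> 1 \<Longrightarrow> norm (f r) \<le> C"
    and le2: "\<And>r. r \<ge> 1 \<Longrightarrow> norm (f r) \<le> D * r powr (-q)"
  shows "integrable halfline f"
proof -
  have "((\<lambda>r. r powr (-q)) has_integral - (1 powr (- q + 1)) / (- q + 1)) {1..}"
    using q by (intro has_integral_powr_to_inf) auto
  then have "set_integrable lebesgue {1..} (\<lambda>r. r powr (-q))"
    by (intro nonnegative_absolutely_integrable_1) auto
  then have i: "integrable lborel (\<lambda>r. indicator {1..} r * r powr (-q))"
    unfolding set_integrable_def by (subst (asm) integrable_completion) auto
  have j: "integrable lborel (\<lambda>r. indicator {0..1::real} r *\<^sub>R C)"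
    by (intro integrable_scaleR_left integrable_real_indicator) auto
  have "integrable lborel (\<lambda>r. indicator {0<..} r *\<^sub>R f r)"
  proof (rule Bochner_Integration.integrable_bound)
    show "integrable lborel (\<lambda>r. indicator {0..1::real} r *\<^sub>R C + D * (indicator {1..} r * r powr (-q)))"
      using i j by auto
    \<comment> \<open>The majorant's indicators overlap at r = 1, and the first also covers r = 0;
      the signs of both constants settle these points.\<close>
    have "0 \<le> C" using order_trans[OF norm_ge_zero le1[of 1]] by simp
    moreover have "0 \<le> D" using order_trans[OF norm_ge_zero le2[of 1]] by simp
    ultimately have "norm (indicator {0<..} r *\<^sub>R f r) \<le>
        indicator {0..1::real} r *\<^sub>R C + D * (indicator {1..} r * r powr (-q))" for r
      using le1[of r] le2[of r] by (cases "r > 0"; cases "r < 1"; cases "r = 1") (simp_all add: indicator_def)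
    then show "AE r in lborel. norm (indicator {0<..} r *\<^sub>R f r) \<le>
        norm (indicator {0..1::real} r *\<^sub>R C + D * (indicator {1..} r * r powr (-q)))"
      by (intro AE_I2) (smt (verit) real_norm_def)
  qed simp
  then show ?thesis by (simp add: integrable_halfline_iff set_integrable_def)
qed

lemma integrable_exp_powr:
  fixes b \<sigma> :: real
  assumes b: "b > 0" and s: "\<sigma> > 0"
  shows "integrable halfline (\<lambda>r. exp (- b * r powr \<sigma>))"
proof -
  \<comment> \<open>A single term of the exponential series, exp t \<ge> t^k / k!, yields the tail
    r^(- \<sigma> k); this choice makes \<sigma> k > 2.\<close>
  obtain k :: nat where k: "2 / \<sigma> < real k" using reals_Archimedean2 by blast
  show ?thesis
  proof (rule integrable_halfline_powr_tail[where q = "\<sigma> * k" and C = 1 and D = "fact k / b ^ k"])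
    show "1 < \<sigma> * real k" using k s by (simp add: field_simps)
    fix r :: real
    show "norm (exp (- b * r powr \<sigma>)) \<le> 1" using b by simp
    assume r: "r \<ge> 1"
    let ?t = "b * r powr \<sigma>"
    have t: "?t > 0" using r b by simp
    have "(\<lambda>n. ?t ^ n / fact n) sums exp ?t"
      using exp_converges[of ?t] by (simp add: scaleR_conv_of_real field_simps)
    then have "(\<Sum>n<Suc k. ?t ^ n / fact n) \<le> exp ?t"
      using t sum_le_suminf[of "\<lambda>n. ?t ^ n / fact n" "{..<Suc k}"] by (simp add: sums_iff)
    moreover have "?t ^ k / fact k \<le> (\<Sum>n<Suc k. ?t ^ n / fact n)"
      using t by (intro member_le_sum) auto
    ultimately have "?t ^ k / fact k \<le> exp ?t" by linarith
    moreover have "?t ^ k > 0" using t by (rule zero_less_power)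
    ultimately have "exp (- ?t) \<le> fact k / ?t ^ k"
      by (simp only: exp_minus) (simp add: divide_simps mult.commute[of "fact k"])
    also have "\<dots> = fact k / b ^ k * r powr (- (\<sigma> * real k))"
      using r by (simp add: power_mult_distrib powr_minus powr_powr [symmetric] powr_realpow divide_inverse)
    finally show "norm (exp (- b * r powr \<sigma>)) \<le> fact k / b ^ k * r powr (- (\<sigma> * real k))"
      by simp
  qed simp
qed

lemma integrable_exp_linear_powr:
  fixes c y \<sigma> :: real
  assumes c: "c > 0" and y: "y \<ge> 0" and s: "0 < \<sigma>" "\<sigma> < 1"
  shows "integrable halfline (\<lambda>r. exp (- c * r + y * r powr \<sigma>))"
proof -
  \<comment> \<open>Chosen so that y \<delta> r uses at most half of the decay c r; the summand 1
    keeps the quotient defined at y = 0.\<close>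
  define \<delta> where "\<delta> = c / (2 * (y + 1))"
  have d: "\<delta> > 0" using c y by (simp add: \<delta>_def)
  define R where "R = \<delta> powr (1 / (\<sigma> - 1))"
  have R: "R > 0" "R powr (\<sigma> - 1) = \<delta>" using d s by (auto simp: R_def powr_powr)
  \<comment> \<open>\<open>R\<close> is where \<open>r powr \<sigma>\<close> crosses \<open>\<delta> * r\<close>.\<close>
  have le: "r powr \<sigma> \<le> \<delta> * r + R powr \<sigma>" if r: "r > 0" for r
  proof (cases "r \<le> R")
    case True
    then have "r powr \<sigma> \<le> R powr \<sigma>" using r s by (intro powr_mono2) auto
    then show ?thesis using d r by (smt (verit) mult_pos_pos)
  next
    case False
    then have "r powr (\<sigma> - 1) \<le> R powr (\<sigma> - 1)" using R r s by (intro powr_mono2') auto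
    then have "r * r powr (\<sigma> - 1) \<le> r * \<delta>" using R r by (intro mult_left_mono) auto
    also have "r * r powr (\<sigma> - 1) = r powr \<sigma>" using r by (simp add: powr_diff)
    finally show ?thesis using R by (smt (verit) mult.commute powr_ge_zero)
  qed
  have "integrable halfline (\<lambda>r. exp (- (c / 2) * r))"
    using c by (intro integrable_halfline_exp) auto
  then have "integrable halfline (\<lambda>r. exp (y * R powr \<sigma>) * exp (- (c / 2) * r))"
    by (rule integrable_mult_right)
  then show ?thesis
  proof (rule integrable_halfline_bound)
    fix r :: real assume r: "r > 0"
    have "y * r powr \<sigma> \<le> y * (\<delta> * r + R powr \<sigma>)" using le[OF r] y by (intro mult_left_mono)
    also have "\<dots> \<le> (y + 1) * \<delta> * r + y * R powr \<sigma>" using r d by (simp add: algebra_simps)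
    also have "(y + 1) * \<delta> = c / 2" using y by (simp add: \<delta>_def field_simps)
    finally show "norm (exp (- c * r + y * r powr \<sigma>)) \<le> exp (y * R powr \<sigma>) * exp (- (c / 2) * r)"
      by (simp add: exp_add [symmetric])
  qed simp
qed

subsection \<open>Ray integrals\<close>

text \<open>Every partial sum of the series of exp z is bounded by exp |z|, so one integrable
  majorant permits dominated convergence. Both series expansions below, for the complex Gamma
  integral and for the ray integral, rest on this.\<close>

lemma halfline_exp_sums:
  fixes h z :: "real \<Rightarrow> complex"
  assumes [measurable]: "h \<in> borel_measurable borel" "z \<in> borel_measurable borel"
    and int: "integrable halfline (\<lambda>r. norm (h r) * exp (norm (z r)))"
  shows "(\<lambda>n. integral\<^sup>L halfline (\<lambda>r. h r * (z r ^ n / fact n))) sums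
           integral\<^sup>L halfline (\<lambda>r. h r * exp (z r))"
proof -
  have part: "(\<Sum>n<N. norm (w ^ n / fact n)) \<le> exp (norm w)" for w :: complex and N
  proof -
    have "(\<lambda>n. norm w ^ n / fact n) sums exp (norm w)"
      using exp_converges[of "norm w"] by (simp add: scaleR_conv_of_real field_simps)
    then show ?thesis
      using sum_le_suminf[of "\<lambda>n. norm w ^ n / fact n" "{..<N}"] 
      by (simp add: sums_iff norm_divide norm_power)
  qed
  have term_int: "integrable halfline (\<lambda>r. h r * (z r ^ n / fact n))" for n
  proof (rule integrable_halfline_bound[OF int])
    fix r :: real
    have "norm (z r ^ n / fact n) \<le> (\<Sum>n<Suc n. norm (z r ^ n / fact n))"
      by (rule member_le_sum) auto
    also have "\<dots> \<le> exp (norm (z r))" by (rule part)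
    finally show "norm (h r * (z r ^ n / fact n)) \<le> norm (h r) * exp (norm (z r))"
      unfolding norm_mult[of "h r"] by (intro mult_left_mono) auto
  qed simp
  have "(\<lambda>N. integral\<^sup>L halfline (\<lambda>r. \<Sum>n<N. h r * (z r ^ n / fact n))) \<longlonglongrightarrow>
      integral\<^sup>L halfline (\<lambda>r. h r * exp (z r))"
  proof (rule integral_dominated_convergence[OF _ _ int])
    show "AE r in halfline. (\<lambda>N. \<Sum>n<N. h r * (z r ^ n / fact n)) \<longlonglongrightarrow> h r * exp (z r)"
    proof (intro AE_halflineI)
      fix r
      have "(\<lambda>n. z r ^ n / fact n) sums exp (z r)"
        using exp_converges[of "z r"] by (simp add: scaleR_conv_of_real field_simps)
      then show "(\<lambda>N. \<Sum>n<N. h r * (z r ^ n / fact n)) \<longlonglongrightarrow> h r * exp (z r)"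
        by (metis sums_mult sums_def)
    qed
    fix N
    show "AE r in halfline. norm (\<Sum>n<N. h r * (z r ^ n / fact n)) \<le> norm (h r) * exp (norm (z r))"
    proof (intro AE_halflineI)
      fix r
      have "norm (\<Sum>n<N. h r * (z r ^ n / fact n)) \<le> norm (h r) * (\<Sum>n<N. norm (z r ^ n / fact n))"
        unfolding sum_distrib_left norm_mult [symmetric] by (rule norm_sum)
      also have "\<dots> \<le> norm (h r) * exp (norm (z r))"
        by (intro mult_left_mono part) auto
      finally show "norm (\<Sum>n<N. h r * (z r ^ n / fact n)) \<le> norm (h r) * exp (norm (z r))" .
    qed
  qed simp_all
  then show ?thesis
    using term_int by (simp add: sums_def)
qed

text \<open>The factor \<open>exp (- c * r)\<close> is expanded around \<open>exp (- A * r)\<close> for a real \<open>A\<close> so large that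
  \<open>\<bar>A - c\<bar> < A\<close>; the integrated series is then a convergent binomial series.\<close>

lemma Gamma_halfline_complex:
  fixes a :: real and c :: complex
  assumes a: "a > 0" and c: "Re c > 0"
  shows "integral\<^sup>L halfline (\<lambda>r. of_real (r powr (a - 1)) * exp (- c * of_real r)) =
           of_real (Gamma a) * c powr (- of_real a)"
proof -
  \<comment> \<open>Since |A - c|^2 = A^2 - 2 A Re c + |c|^2, the required |A - c| < A means A >
    |c|^2 / (2 Re c).\<close>
  define A where "A = (cmod c)\<^sup>2 / (2 * Re c) + 1"
  have A: "A > 0" unfolding A_def using c by (intro add_nonneg_pos) auto
  have "(cmod (of_real A - c))\<^sup>2 = A\<^sup>2 - 2 * A * Re c + (cmod c)\<^sup>2"
    unfolding cmod_power2 by (simp add: power2_eq_square algebra_simps)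
  also have "2 * A * Re c = (cmod c)\<^sup>2 + 2 * Re c"
    using c by (simp add: A_def field_simps)
  finally have "(cmod (of_real A - c))\<^sup>2 < A\<^sup>2" using c by simp
  then have less: "cmod (of_real A - c) < A" using A by (simp add: power2_less_imp_less)
  \<comment> \<open>The decay rate that is left once exp |z| has been paid for.\<close>
  define B where "B = A - cmod (of_real A - c)"
  have B: "B > 0" using less by (simp add: B_def)
  define w where "w = (c - of_real A) / of_real A"
  have w: "norm w < 1" using less A by (simp add: w_def norm_divide norm_minus_commute)
  define h :: "real \<Rightarrow> complex" where "h = (\<lambda>r. of_real (r powr (a - 1) * exp (- A * r)))"
  define z where "z = (\<lambda>r. (of_real A - c) * of_real r)"
  have [measurable]: "h \<in> borel_measurable borel" "z \<in> borel_measurable borel"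
    by (auto simp: h_def z_def)
  have "integrable halfline (\<lambda>r. norm (h r) * exp (norm (z r)))"
  proof (rule integrable_halfline_bound[OF Gamma_halfline(1)[OF a B]])
    fix r :: real assume "r > 0"
    moreover from this have "norm (z r) = cmod (of_real A - c) * r"
      by (simp add: z_def norm_mult)
    ultimately show "norm (norm (h r) * exp (norm (z r))) \<le> r powr (a - 1) * exp (- B * r)"
      by (simp add: h_def norm_mult B_def algebra_simps flip: exp_add)
  qed simp
  then have *: "(\<lambda>n. integral\<^sup>L halfline (\<lambda>r. h r * (z r ^ n / fact n))) sums
           integral\<^sup>L halfline (\<lambda>r. h r * exp (z r))"
    by (intro halfline_exp_sums) auto
  have term_eq: "integral\<^sup>L halfline (\<lambda>r. h r * (z r ^ n / fact n)) =
     (of_real (Gamma a) * of_real (A powr - a)) * (((- of_real a) gchoose n) * w ^ n)" for n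
  proof -
    have "integral\<^sup>L halfline (\<lambda>r. h r * (z r ^ n / fact n)) =
      integral\<^sup>L halfline (\<lambda>r. ((of_real A - c) ^ n / fact n) *
         of_real (r powr (a + n - 1) * exp (- A * r)))"
    proof (intro integral_cong_AE AE_halflineI)
      fix r :: real assume r: "r > 0"
      have "r powr (a + n - 1) = r powr (a - 1) * r ^ n"
        using r by (simp add: powr_realpow [symmetric] flip: powr_add) (simp add: algebra_simps)
      then show "h r * (z r ^ n / fact n) = ((of_real A - c) ^ n / fact n) *
         of_real (r powr (a + n - 1) * exp (- A * r))"
        by (simp add: h_def z_def power_mult_distrib)
    qed simp_all
    also have "\<dots> = ((of_real A - c) ^ n / fact n) * of_real (Gamma (a + n) * A powr - (a + n))"
      using Gamma_halfline(2)[of "a + n" A] a A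
      by (subst integral_mult_right_zero, subst integral_complex_of_real) simp
    also have "Gamma (a + n) = pochhammer a n * Gamma a"
      using a pochhammer_Gamma[of a n] Gamma_real_pos[OF a] by (auto simp: field_simps nonpos_Ints_def)
    also have "A powr - (a + n) = A powr - a / A ^ n"
      using A by (simp add: powr_diff powr_realpow)
    \<comment> \<open>This sign turns \<open>pochhammer a n / fact n\<close> into the binomial
      coefficient of - a.\<close>
    also have "(of_real A - c) ^ n = (- 1) ^ n * (c - of_real A) ^ n"
      by (simp flip: power_mult_distrib)
    finally show ?thesis
      unfolding gbinomial_pochhammer w_def
      by (simp add: pochhammer_of_real power_divide field_simps)
  qed
  have "(\<lambda>n. (of_real (Gamma a) * of_real (A powr - a)) * (((- of_real a) gchoose n) * w ^ n)) sums
     ((of_real (Gamma a) * of_real (A powr - a)) * (1 + w) powr (- of_real a))"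
    by (intro sums_mult gen_binomial_complex w)
  with * have "integral\<^sup>L halfline (\<lambda>r. h r * exp (z r)) =
     (of_real (Gamma a) * of_real (A powr - a)) * (1 + w) powr (- of_real a)"
    unfolding term_eq using sums_unique2 by blast
  also have "1 + w = c / of_real A" using A by (simp add: w_def field_simps)
  also have "of_real (Gamma a) * of_real (A powr - a) * (c / of_real A) powr (- of_real a) =
      of_real (Gamma a) * c powr (- of_real a)"
  proof -
    have "c \<noteq> 0" using c by auto
    then have "Ln (c / of_real A) = Ln c - of_real (ln A)"
      using Ln_times_of_real[of "inverse A" c] A Ln_of_real[of "inverse A"]
      by (simp add: divide_inverse ln_inverse mult.commute del: Ln_of_real)
    then have "(c / of_real A) powr (- of_real a) = c powr (- of_real a) * of_real (A powr a)"
      using \<open>c \<noteq> 0\<close> A by (simp add: powr_def exp_of_real [symmetric] flip: exp_add) (simp add: algebra_simps)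
    then show ?thesis using A by (simp add: powr_minus field_simps)
  qed
  also have "integral\<^sup>L halfline (\<lambda>r. h r * exp (z r)) =
    integral\<^sup>L halfline (\<lambda>r. of_real (r powr (a - 1)) * exp (- c * of_real r))"
    by (intro Bochner_Integration.integral_cong refl)
       (simp add: h_def z_def exp_of_real [symmetric] mult.assoc flip: exp_add, simp add: algebra_simps)
  finally show ?thesis .
qed

text \<open>Euler's reflection formula. At integers t both sides vanish, so coefficients at poles of
  Gamma need no separate treatment.\<close>

lemma rGamma_minus_real:
  fixes t :: real
  assumes "t > 0"
  shows "rGamma (- t) = - Gamma (1 + t) * sin (pi * t) / pi"
proof -
  have "rGamma (- of_real t) * rGamma (1 - (- of_real t) :: complex) = sin (of_real pi * - of_real t) / of_real pi"
    by (rule rGamma_reflection_complex)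
  also have "rGamma (- of_real t :: complex) = of_real (rGamma (- t))"
    by (simp flip: rGamma_complex_of_real)
  also have "rGamma (1 - (- of_real t) :: complex) = of_real (rGamma (1 + t))"
    by (simp flip: rGamma_complex_of_real)
  also have "sin (of_real pi * - of_real t) / of_real pi = (of_real (- sin (pi * t) / pi) :: complex)"
    by (simp flip: sin_of_real)
  finally have "rGamma (- t) * rGamma (1 + t) = - sin (pi * t) / pi"
    by (simp only: of_real_mult [symmetric] of_real_eq_iff)
  moreover have "Gamma (1 + t) > 0" using assms by (intro Gamma_real_pos) auto
  ultimately show ?thesis by (simp only: rGamma_inverse_Gamma[of "1 + t"]) (simp add: field_simps)
qed

text \<open>No contour is moved: each term is a complex Gamma integral, and its phases add up to pi
  + pi \<sigma> n whatever \<theta> is. The imaginary part leaves - sin (pi \<sigma> n), which the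
  reflection formula combines with Gamma (1 + \<sigma> n) into
  \<open>rGamma (- \<sigma> * n)\<close>. Any real y is allowed.\<close>

lemma reduced_wright_ray:
  fixes \<sigma> y \<theta> :: real
  assumes s: "0 < \<sigma>" "\<sigma> < 1" and t: "pi / 2 < \<theta>" "\<theta> < pi"
  shows "reduced_wright (- \<sigma>) (- y) = Im (integral\<^sup>L halfline (\<lambda>r.
           cis \<theta> * exp (of_real r * cis \<theta>) * exp (- of_real (y * r powr \<sigma>) * cis (\<sigma> * \<theta>)))) / pi"
proof -
  define h where "h = (\<lambda>r. cis \<theta> * exp (of_real r * cis \<theta>))"
  define z where "z = (\<lambda>r. - of_real (y * r powr \<sigma>) * cis (\<sigma> * \<theta>))"
  have [measurable]: "h \<in> borel_measurable borel" "z \<in> borel_measurable borel"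
    by (auto simp: h_def z_def)
  have cos: "cos \<theta> < 0" using cos_lt_zero_pi[of \<theta>] t by auto
  have "norm (h r) * exp (norm (z r)) = exp (- (- cos \<theta>) * r + \<bar>y\<bar> * r powr \<sigma>)" for r
    by (simp add: h_def z_def norm_mult abs_mult exp_add [symmetric] mult.commute)
  then have *: "(\<lambda>n. integral\<^sup>L halfline (\<lambda>r. h r * (z r ^ n / fact n))) sums
           integral\<^sup>L halfline (\<lambda>r. h r * exp (z r))"
    using integrable_exp_linear_powr[of "- cos \<theta>" "\<bar>y\<bar>" \<sigma>] s cos
    by (intro halfline_exp_sums) auto
  have term_eq: "integral\<^sup>L halfline (\<lambda>r. h r * (z r ^ n / fact n)) =
     of_real (- ((- y) ^ n / fact n * Gamma (1 + \<sigma> * n))) * cis (pi * (\<sigma> * n))" for n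
  proof -
    have "integral\<^sup>L halfline (\<lambda>r. h r * (z r ^ n / fact n)) =
      integral\<^sup>L halfline (\<lambda>r. (of_real ((- y) ^ n / fact n) * cis \<theta> * cis (\<sigma> * \<theta>) ^ n) *
         (of_real (r powr (1 + \<sigma> * n - 1)) * exp (- cis (\<theta> - pi) * of_real r)))"
    proof (intro integral_cong_AE AE_halflineI)
      fix r :: real assume r: "r > 0"
      have "(r powr \<sigma>) ^ n = r powr (\<sigma> * n)"
        using r by (simp add: powr_powr [symmetric] powr_realpow)
      moreover have "cis (\<theta> - pi) = - cis \<theta>" by (simp flip: cis_divide)
      moreover have "z r ^ n = of_real ((-y) ^ n * (r powr \<sigma>) ^ n) * cis (\<sigma> * \<theta>) ^ n"
        unfolding power_mult_distrib [symmetric] of_real_power by (simp add: z_def power_mult_distrib [symmetric])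
      ultimately show "h r * (z r ^ n / fact n) = (of_real ((- y) ^ n / fact n) * cis \<theta> * cis (\<sigma> * \<theta>) ^ n) *
         (of_real (r powr (1 + \<sigma> * n - 1)) * exp (- cis (\<theta> - pi) * of_real r))"
        by (simp add: h_def mult_ac)
    qed simp_all
    also have "\<dots> = (of_real ((- y) ^ n / fact n) * cis \<theta> * cis (\<sigma> * \<theta>) ^ n) *
       (of_real (Gamma (1 + \<sigma> * n)) * cis (\<theta> - pi) powr (- of_real (1 + \<sigma> * n)))"
      using s cos by (subst integral_mult_right_zero, subst Gamma_halfline_complex)
        (auto simp: add_pos_nonneg)
    \<comment> \<open>As \<theta> - pi lies in (- pi/2, 0), it is the principal argument of - cis
      \<theta>, and no branch correction arises.\<close>
    also have "cis (\<theta> - pi) powr (- of_real (1 + \<sigma> * n)) = cis (- (1 + \<sigma> * n) * (\<theta> - pi))"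
      using t by (simp add: powr_def Ln_cis cis_conv_exp mult_ac)
    also have "cis (\<sigma> * \<theta>) ^ n = cis (n * (\<sigma> * \<theta>))" by (rule Complex.DeMoivre)
    also have "of_real ((- y) ^ n / fact n) * cis \<theta> * cis (n * (\<sigma> * \<theta>)) *
       (of_real (Gamma (1 + \<sigma> * n)) * cis (- (1 + \<sigma> * n) * (\<theta> - pi))) =
       of_real ((- y) ^ n / fact n * Gamma (1 + \<sigma> * n)) * 
        cis (\<theta> + n * (\<sigma> * \<theta>) + (- (1 + \<sigma> * n) * (\<theta> - pi)))"
      by (simp add: cis_mult [symmetric] mult_ac)
    also have "\<theta> + n * (\<sigma> * \<theta>) + (- (1 + \<sigma> * n) * (\<theta> - pi)) = pi + pi * (\<sigma> * n)"
      by (simp add: algebra_simps)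
    finally show ?thesis by (simp add: cis_mult [symmetric])
  qed
  have "(\<lambda>n. Im (of_real (- ((- y) ^ n / fact n * Gamma (1 + \<sigma> * n))) * cis (pi * (\<sigma> * n))) / pi) sums
     (Im (integral\<^sup>L halfline (\<lambda>r. h r * exp (z r))) / pi)"
    using * unfolding term_eq by (intro sums_divide sums_Im)
  moreover have "Im (of_real c * cis t) = c * sin t" for c t by simp
  ultimately have "(\<lambda>n. - ((- y) ^ n / fact n * Gamma (1 + \<sigma> * n)) * sin (pi * (\<sigma> * n)) / pi) sums
     (Im (integral\<^sup>L halfline (\<lambda>r. h r * exp (z r))) / pi)" (is "?f sums ?S")
    by (simp only:)
  \<comment> \<open>The term n = 0 is real before the imaginary part is taken, hence contributes 0;
    this matches a series starting at n = 1.\<close>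
  then have "(\<lambda>n. ?f (Suc n)) sums ?S"
    by (subst sums_Suc_iff) simp
  moreover have "?f (Suc n) = (- y) ^ Suc n / fact (Suc n) * rGamma (- \<sigma> * real (Suc n))" for n
    using rGamma_minus_real[of "\<sigma> * real (Suc n)"] s by simp
  ultimately have "reduced_wright (- \<sigma>) (- y) = ?S"
    unfolding reduced_wright_def by (simp add: sums_iff)
  then show ?thesis by (simp add: h_def z_def)
qed

subsection \<open>Cauchy's formula in the right half-plane\<close>

lemma integral_lborel_halfline:
  fixes F :: "real \<Rightarrow> 'a::{banach, second_countable_topology}"
  assumes [measurable]: "F \<in> borel_measurable borel"
    and i1: "integrable halfline F" and i2: "integrable halfline (\<lambda>r. F (- r))"
  shows "integrable lborel F"
    and "integral\<^sup>L lborel F = integral\<^sup>L halfline F + integral\<^sup>L halfline (\<lambda>r. F (- r))"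
proof -
  let ?P = "\<lambda>r. indicator {0<..} r *\<^sub>R F r" and ?N = "\<lambda>r. indicator {..<0} r *\<^sub>R F r"
  have ind: "indicator {..<0} (- r) = (indicator {0<..} r :: real)" for r :: real
    by (auto simp: indicator_def)
  have P: "integrable lborel ?P" 
    using i1 by (simp add: integrable_halfline_iff set_integrable_def)
  have "integrable lborel (\<lambda>r. ?N (0 + (-1) * r))"
    using i2 by (simp add: integrable_halfline_iff set_integrable_def ind)
  then have N: "integrable lborel ?N"
    by (subst (asm) lborel_integrable_real_affine_iff) auto
  have "AE r in lborel. r \<noteq> (0::real)" by (rule AE_lborel_singleton)
  then have AE: "AE r in lborel. ?P r + ?N r = F r"
    by eventually_elim (auto simp: indicator_def)
  show "integrable lborel F"
    by (rule integrable_cong_AE_imp[OF Bochner_Integration.integrable_add[OF P N]])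
       (use AE in \<open>auto elim: eventually_mono\<close>)
  have "integral\<^sup>L lborel F = integral\<^sup>L lborel (\<lambda>r. ?P r + ?N r)"
    by (rule integral_cong_AE) (use AE in \<open>auto elim: eventually_mono\<close>)
  also have "\<dots> = integral\<^sup>L lborel ?P + integral\<^sup>L lborel ?N"
    using P N by (rule Bochner_Integration.integral_add)
  also have "integral\<^sup>L lborel ?N = integral\<^sup>L lborel (\<lambda>r. ?N (0 + (-1) * r))"
    using lborel_integral_real_affine[of "-1" ?N 0] by simp
  finally show "integral\<^sup>L lborel F = integral\<^sup>L halfline F + integral\<^sup>L halfline (\<lambda>r. F (- r))"
    by (simp add: integral_halfline set_lebesgue_integral_def ind)
qed

text \<open>The future Laplace transform of F, on the principal branch. The convention
  \<open>0 powr a = 0\<close> gives it the value 1 at the branch point, which makes it continuous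
  there within the half-plane.\<close>

definition cexp_powr :: "real \<Rightarrow> real \<Rightarrow> complex \<Rightarrow> complex" where
  "cexp_powr x \<sigma> u = exp (- of_real x * u powr of_real \<sigma>)"

lemma powr_of_real_cis:
  assumes "r > 0" "-pi < t" "t \<le> pi"
  shows "(of_real r * cis t) powr of_real \<sigma> = of_real (r powr \<sigma>) * cis (\<sigma> * t)"
proof -
  have "Ln (of_real r * cis t) = of_real (ln r) + \<i> * of_real t"
    using assms Ln_times_of_real[of r "cis t"] by (simp add: Ln_cis Ln_of_real mult.commute)
  then show ?thesis
    using assms by (simp add: powr_def exp_add algebra_simps cis_conv_exp flip: exp_of_real)
qed

text \<open>On the closed half-plane |arg u| \<le> pi/2, so Re u^\<sigma> \<ge> |u|^\<sigma> cos
  (\<sigma> pi/2). The cosine is positive because \<sigma> < 1, so the decay is uniform in all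
  directions.\<close>

lemma norm_cexp_powr_le:
  assumes s: "0 < \<sigma>" "\<sigma> < 1" and x: "x > 0" and u: "Re u \<ge> 0"
  shows "norm (cexp_powr x \<sigma> u) \<le> exp (- (x * cos (\<sigma> * (pi / 2))) * norm u powr \<sigma>)"
proof (cases "u = 0")
  case False
  then have "\<bar>Im (Ln u)\<bar> \<le> pi / 2" using u Re_Ln_pos_le by blast
  then have "cos (\<sigma> * (pi / 2)) \<le> cos (\<sigma> * \<bar>Im (Ln u)\<bar>)"
    using s by (intro cos_monotone_0_pi_le mult_left_mono)
      (auto intro: order_trans[OF mult_right_mono[of \<sigma> 1 "pi/2"]])
  also have "\<dots> = cos (\<sigma> * Im (Ln u))"
    using cos_abs_real[of "\<sigma> * Im (Ln u)"] s by (simp add: abs_mult)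
  finally have "norm u powr \<sigma> * cos (\<sigma> * (pi / 2)) \<le> norm u powr \<sigma> * cos (\<sigma> * Im (Ln u))"
    by (intro mult_left_mono) auto
  also have "\<dots> = Re (u powr of_real \<sigma>)"
    using False by (simp add: powr_def Re_exp)
  finally show ?thesis using x
    by (simp add: cexp_powr_def mult_ac)
qed (simp add: cexp_powr_def)

lemma continuous_on_cexp_powr:
  assumes "0 < \<sigma>"
  shows "continuous_on {u. Re u \<ge> 0} (cexp_powr x \<sigma>)"
  unfolding cexp_powr_def using assms by (intro continuous_intros) auto

lemma borel_measurable_cexp_powr_imag:
  assumes "0 < \<sigma>"
  shows "(\<lambda>y. cexp_powr x \<sigma> (\<i> * of_real y)) \<in> borel_measurable borel"
  by (intro borel_measurable_continuous_onI continuous_on_compose2[OF continuous_on_cexp_powr[OF assms]]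
     continuous_intros) auto

lemma integrable_cexp_powr_imag:
  assumes s: "0 < \<sigma>" "\<sigma> < 1" and x: "x > 0"
  shows "integrable lborel (\<lambda>y. cexp_powr x \<sigma> (\<i> * of_real y))"
proof -
  note [measurable] = borel_measurable_cexp_powr_imag[OF s(1)]
  have "x * cos (\<sigma> * (pi / 2)) > 0"
    using s x by (intro mult_pos_pos cos_gt_zero_pi) (auto intro: order_less_trans[of _ 0])
  then have i: "integrable halfline (\<lambda>r. exp (- (x * cos (\<sigma> * (pi / 2))) * r powr \<sigma>))"
    using s by (intro integrable_exp_powr)
  show ?thesis
  proof (rule integral_lborel_halfline(1)[OF _ integrable_halfline_bound[OF i] integrable_halfline_bound[OF i]])
    show "(\<lambda>r. cexp_powr x \<sigma> (\<i> * of_real (- r))) \<in> borel_measurable borel"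
      by (rule measurable_compose[OF _ borel_measurable_cexp_powr_imag[OF s(1)]]) simp
    fix r :: real assume "r > 0"
    then show "norm (cexp_powr x \<sigma> (\<i> * of_real r)) \<le> exp (- (x * cos (\<sigma> * (pi / 2))) * r powr \<sigma>)"
      and "norm (cexp_powr x \<sigma> (\<i> * of_real (- r))) \<le> exp (- (x * cos (\<sigma> * (pi / 2))) * r powr \<sigma>)"
      using norm_cexp_powr_le[OF s x, of "\<i> * of_real r"] norm_cexp_powr_le[OF s x, of "\<i> * of_real (- r)"]
      by (simp_all add: norm_mult)
  qed simp_all
qed

text \<open>Cauchy's formula on rectangles whose left side lies on the imaginary axis. On the other
  three sides the exponential decay outweighs their length.\<close>

lemma cauchy_cexp_powr_imag:
  assumes s: "0 < \<sigma>" "\<sigma> < 1" and x: "x > 0" and p: "Re p > 0"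
  shows "(LINT y|lborel. cexp_powr x \<sigma> (\<i> * of_real y) / (p - \<i> * of_real y)) = 2 * pi * cexp_powr x \<sigma> p"
proof -
  note [measurable] = borel_measurable_cexp_powr_imag[OF s(1)]
  define f where "f = cexp_powr x \<sigma>"
  define g where "g = (\<lambda>w. f w / (w - p))"
  define F where "F = (\<lambda>y. f (\<i> * of_real y) / (p - \<i> * of_real y))"
  define b where "b = x * cos (\<sigma> * (pi / 2))"
  have b: "b > 0" unfolding b_def
    using s x by (intro mult_pos_pos cos_gt_zero_pi) (auto intro: order_less_trans[of _ 0])
  have [measurable]: "F \<in> borel_measurable borel" unfolding F_def f_def by measurable
  have F_int: "integrable lborel F"
  proof (rule Bochner_Integration.integrable_bound)
    show "integrable lborel (\<lambda>y. cexp_powr x \<sigma> (\<i> * of_real y) / of_real (Re p))"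
      using integrable_cexp_powr_imag[OF s x] by simp
    have "norm (F y) \<le> norm (cexp_powr x \<sigma> (\<i> * of_real y) / of_real (Re p))" for y
    proof -
      have "Re p \<le> norm (p - \<i> * of_real y)"
        using complex_Re_le_cmod[of "p - \<i> * of_real y"] by simp
      moreover from this p have "0 < norm (p - \<i> * of_real y)" by linarith
      ultimately show ?thesis using p
        by (auto simp: F_def f_def norm_divide intro!: divide_left_mono)
    qed
    then show "AE y in lborel. norm (F y) \<le> norm (cexp_powr x \<sigma> (\<i> * of_real y) / of_real (Re p))"
      by simp
  qed simp
  have conv: "(\<lambda>n. LINT y:{- real n..real n}|lborel. F y) \<longlonglongrightarrow> integral\<^sup>L lborel F"
    unfolding set_lebesgue_integral_def
  proof (rule integral_dominated_convergence[where w = "\<lambda>y. norm (F y)"])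
    show "AE y in lborel. (\<lambda>n. indicator {- real n..real n} y *\<^sub>R F y) \<longlonglongrightarrow> F y"
    proof (intro AE_I2 tendsto_eventually)
      fix y :: real
      show "\<forall>\<^sub>F n in sequentially. indicator {- real n..real n} y *\<^sub>R F y = F y"
        using eventually_ge_at_top[of "nat \<lceil>\<bar>y\<bar>\<rceil>"]
        by eventually_elim (auto simp: indicator_def)
    qed
  qed (use F_int in \<open>auto simp: indicator_def\<close>)
  \<comment> \<open>R > 2 |p| puts p inside the rectangle and gives |w - p| \<ge> R/2 on the three
    outer sides. Their total length is 4 R, whence the factor 8.\<close>
  have bound: "norm ((LINT y:{- R..R}|lborel. F y) - 2 * pi * f p) \<le> 8 * exp (- b * R powr \<sigma>)"
    if R: "R > 2 * norm p" "R > 0" for R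
  proof -
    define a1 where "a1 = Complex 0 (- R)"
    define a2 where "a2 = Complex R (- R)"
    define a3 where "a3 = Complex R R"
    define a4 where "a4 = Complex 0 R"
    have rp: "rectpath a1 a3 = linepath a1 a2 +++ linepath a2 a3 +++ linepath a3 a4 +++ linepath a4 a1"
      by (simp add: rectpath_def a1_def a2_def a3_def a4_def Let_def)
    have pR: "\<bar>Re p\<bar> < R" "\<bar>Im p\<bar> < R"
      using R abs_Re_le_cmod[of p] abs_Im_le_cmod[of p] norm_ge_zero[of p] by linarith+
    let ?S = "{u. Re u \<ge> 0}"
    have sub: "path_image (rectpath a1 a3) \<subseteq> ?S - {p}"
      using R pR p by (subst path_image_rectpath) (auto simp: a1_def a3_def)
    have pin: "p \<in> interior ?S"
    proof (rule interiorI)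
      show "open {u. Re u > 0}" by (rule open_halfspace_Re_gt)
    qed (use p in auto)
    have "(g has_contour_integral (2 * pi * \<i> * winding_number (rectpath a1 a3) p * f p)) (rectpath a1 a3)"
      unfolding g_def
    \<comment> \<open>The left side runs along the boundary of the half-plane and through the branch
      point. The weak form asks for continuity up to the boundary, but for differentiability only
      inside and off 0.\<close>
    proof (rule Cauchy_integral_formula_weak[where S = ?S and k = "{0}"])
      show "convex ?S" by (rule convex_halfspace_Re_ge)
      show "continuous_on ?S f" unfolding f_def by (rule continuous_on_cexp_powr[OF s(1)])
      fix u assume u: "u \<in> interior ?S - {0}"
      then have "Re u \<ge> 0" "u \<noteq> 0" using interior_subset by auto
      then have "u \<notin> \<real>\<^sub>\<le>\<^sub>0" by (auto simp: complex_nonpos_Reals_iff complex_eq_iff)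
      then show "f field_differentiable at u"
        unfolding f_def cexp_powr_def [abs_def] field_differentiable_def
        by (auto intro!: exI derivative_eq_intros)
    qed (use pin p sub in auto)
    moreover have "winding_number (rectpath a1 a3) p = 1"
      using pR p by (intro winding_number_rectpath) (auto simp: a1_def a3_def in_box_complex_iff)
    ultimately have cauchy: "contour_integral (rectpath a1 a3) g = 2 * pi * \<i> * f p"
      by (simp add: contour_integral_unique)
    have pi_eq: "path_image (rectpath a1 a3) = closed_segment a1 a2 \<union> closed_segment a2 a3
        \<union> closed_segment a3 a4 \<union> closed_segment a4 a1"
      unfolding rp by (simp add: path_image_join Un_assoc)
    have gcont: "continuous_on (?S - {p}) g"
      unfolding g_def f_def
      by (intro continuous_intros continuous_on_subset[OF continuous_on_cexp_powr[OF s(1)]]) auto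
    have gi: "g contour_integrable_on linepath a1 a2" "g contour_integrable_on linepath a2 a3"
      "g contour_integrable_on linepath a3 a4" "g contour_integrable_on linepath a4 a1"
      using sub unfolding pi_eq
      by (auto intro!: contour_integrable_continuous_linepath continuous_on_subset[OF gcont])
    have sum: "contour_integral (rectpath a1 a3) g = contour_integral (linepath a1 a2) g
       + (contour_integral (linepath a2 a3) g + (contour_integral (linepath a3 a4) g
       + contour_integral (linepath a4 a1) g))"
      unfolding rp using gi by (simp add: contour_integrable_joinI)
    define B where "B = exp (- b * R powr \<sigma>) / (R / 2)"
    have gB: "norm (g w) \<le> B" if w: "Re w \<ge> 0" "norm w \<ge> R" for w
    proof -
      have "norm (f w) \<le> exp (- b * norm w powr \<sigma>)"
        unfolding f_def b_def by (rule norm_cexp_powr_le[OF s x w(1)])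
      also have "\<dots> \<le> exp (- b * R powr \<sigma>)"
        using b s R w by (auto intro!: mult_left_mono powr_mono2)
      finally have 1: "norm (f w) \<le> exp (- b * R powr \<sigma>)" .
      have "R / 2 \<le> norm (w - p)"
        using R w norm_triangle_ineq2[of w p] by linarith
      then show ?thesis unfolding g_def B_def norm_divide
        using 1 R by (intro frac_le) auto
    qed
    have B: "B \<ge> 0" using R by (simp add: B_def)
    have nrm: "R \<le> norm w" if "\<bar>Re w\<bar> = R \<or> \<bar>Im w\<bar> = R" for w
      using that abs_Re_le_cmod[of w] abs_Im_le_cmod[of w] by linarith
    have 1: "norm (contour_integral (linepath a1 a2) g) \<le> B * norm (a2 - a1)"
      using R by (intro contour_integral_bound_linepath gi B gB nrm)
        (auto simp: a1_def a2_def closed_segment_same_Im closed_segment_eq_real_ivl)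
    have 2: "norm (contour_integral (linepath a2 a3) g) \<le> B * norm (a3 - a2)"
      using R by (intro contour_integral_bound_linepath gi B gB nrm)
        (auto simp: a2_def a3_def closed_segment_same_Re closed_segment_eq_real_ivl)
    have 3: "norm (contour_integral (linepath a3 a4) g) \<le> B * norm (a4 - a3)"
      using R by (intro contour_integral_bound_linepath gi B gB nrm)
        (auto simp: a3_def a4_def closed_segment_same_Im closed_segment_eq_real_ivl)
    have len: "norm (a2 - a1) = R" "norm (a3 - a2) = 2 * R" "norm (a4 - a3) = R"
      using R by (auto simp: a1_def a2_def a3_def a4_def cmod_eq_Im cmod_eq_Re)
    \<comment> \<open>Two signs cancel: this side is traversed downwards, and \<open>g\<close> is
      divided by w - p while \<open>F\<close> is divided by p - w.\<close>
    have "contour_integral (linepath a4 a1) g = - contour_integral (linepath a1 a4) g"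
      using gi by (metis contour_integral_reversepath reversepath_linepath valid_path_linepath)
    also have "contour_integral (linepath a1 a4) g = \<i> * integral {-R..R} (\<lambda>y. g (Complex 0 y))"
      using R by (intro contour_integral_linepath_same_Re) (auto simp: a1_def a4_def)
    also have "(\<lambda>y. g (Complex 0 y)) = (\<lambda>y. - F y)"
      by (auto simp: g_def F_def fun_eq_iff Complex_eq minus_divide_right)
    also have "integral {-R..R} (\<lambda>y. - F y) = - (LINT y:{- R..R}|lborel. F y)"
    proof -
      have "set_integrable lborel {- R..R} F"
        unfolding set_integrable_def by (rule integrable_mult_indicator) (auto intro: F_int)
      then show ?thesis
        by (simp add: set_borel_integral_eq_integral(2))
    qed
    finally have "\<i> * ((LINT y:{- R..R}|lborel. F y) - 2 * pi * f p) = 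
       - (contour_integral (linepath a1 a2) g
       + (contour_integral (linepath a2 a3) g + (contour_integral (linepath a3 a4) g)))"
      using sum unfolding cauchy by (simp add: algebra_simps)
    then have "norm (\<i> * ((LINT y:{- R..R}|lborel. F y) - 2 * pi * f p)) \<le>
       norm (contour_integral (linepath a1 a2) g)
       + (norm (contour_integral (linepath a2 a3) g) + norm (contour_integral (linepath a3 a4) g))"
      by (simp only: norm_minus_cancel) (meson norm_triangle_le add_mono order_refl norm_triangle_ineq)
    also have "\<dots> \<le> B * R + (B * (2 * R) + B * R)"
      using 1 2 3 unfolding len by linarith
    also have "\<dots> = 8 * exp (- b * R powr \<sigma>)"
      using R by (simp add: B_def field_simps)
    finally show ?thesis by (simp add: norm_mult)
  qed
  have "(\<lambda>n. (LINT y:{- real n..real n}|lborel. F y) - 2 * pi * f p) \<longlonglongrightarrow> 0"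
  proof (rule Lim_null_comparison)
    show "\<forall>\<^sub>F n in sequentially. norm ((LINT y:{- real n..real n}|lborel. F y) - 2 * pi * f p)
       \<le> 8 * exp (- b * real n powr \<sigma>)"
      using eventually_gt_at_top[of "nat \<lceil>2 * norm p\<rceil>"]
    proof eventually_elim
      case (elim n)
      then show ?case by (intro bound) linarith+
    qed
    show "(\<lambda>n. 8 * exp (- b * real n powr \<sigma>)) \<longlonglongrightarrow> 0"
      using b s by real_asymp
  qed
  then have "(\<lambda>n. LINT y:{- real n..real n}|lborel. F y) \<longlonglongrightarrow> 2 * pi * f p"
    by (simp add: LIM_zero_iff)
  with conv show ?thesis
    unfolding F_def f_def using LIMSEQ_unique by blast
qed

subsection \<open>The Fourier integral on the imaginary axis\<close>

text \<open>\<open>\<theta> > pi / 2\<close> makes \<open>exp u\<close> decay along the ray \<open>u = r * cis \<theta>\<close>, and \<open>\<sigma> * \<theta> < pi / 2\<close> makes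
  \<open>exp (- y * u powr \<sigma>)\<close> decay there.\<close>

lemma exists_ray_angle:
  assumes "0 < \<sigma>" "\<sigma> < 1"
  obtains \<theta> where "pi / 2 < \<theta>" "\<theta> < pi" "\<sigma> * \<theta> < pi / 2"
proof -
  have "pi / 2 < min pi (pi / 2 / \<sigma>)" using assms by (simp add: field_simps)
  then obtain \<theta> where "pi / 2 < \<theta>" "\<theta> < min pi (pi / 2 / \<sigma>)" using dense by blast
  then show ?thesis using assms by (intro that[of \<theta>]) (auto simp: field_simps)
qed

lemma borel_measurable_reduced_wright [measurable]:
  "reduced_wright \<rho> \<in> borel_measurable borel"
  unfolding reduced_wright_def [abs_def] by measurable

lemma norm_ray_exp:
  "norm (cis \<theta> * exp (of_real r * cis \<theta>) * exp (- of_real t * cis \<phi>)) =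
     exp (cos \<theta> * r - t * cos \<phi>)"
  by (simp add: norm_mult exp_add [symmetric] mult.commute)

text \<open>For angles between pi/2 and a fixed \<theta> with \<sigma> \<theta> < pi/2, the factor
  exp (- y u^\<sigma>) alone supplies the common majorant exp (- y cos (\<sigma> \<theta>)
  r^\<sigma>), which survives the limit.\<close>

lemma reduced_wright_imag_axis:
  assumes s: "0 < \<sigma>" "\<sigma> < 1" and y: "y > 0"
  shows "reduced_wright (- \<sigma>) (- y) = Re (integral\<^sup>L halfline (\<lambda>r.
      exp (\<i> * of_real r) * exp (- of_real (y * r powr \<sigma>) * cis (\<sigma> * (pi / 2))))) / pi"
proof -
  obtain \<theta> where t: "pi / 2 < \<theta>" "\<theta> < pi" "\<sigma> * \<theta> < pi / 2" using exists_ray_angle[OF s] .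
  define q where "q = (\<lambda>\<theta> r. cis \<theta> * exp (of_real r * cis \<theta>) * exp (- of_real (y * r powr \<sigma>) * cis (\<sigma> * \<theta>)))"
  \<comment> \<open>Falls from \<theta> to pi/2 but stays strictly above it, so the ray formula
    applies at every \<open>T n\<close>.\<close>
  define T where "T = (\<lambda>n. pi / 2 + (\<theta> - pi / 2) * inverse (real (Suc n)))"
  have T: "pi / 2 < T n" "T n \<le> \<theta>" for n
  proof -
    show "pi / 2 < T n" using t by (simp add: T_def)
    have "(\<theta> - pi / 2) * inverse (real (Suc n)) \<le> (\<theta> - pi / 2) * 1"
      using t by (intro mult_left_mono) (auto simp: field_simps)
    then show "T n \<le> \<theta>" by (simp add: T_def)
  qed
  have Tlim: "T \<longlonglongrightarrow> pi / 2"
  proof -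
    have "T \<longlonglongrightarrow> pi / 2 + (\<theta> - pi / 2) * 0"
      unfolding T_def by (intro tendsto_intros LIMSEQ_inverse_real_of_nat)
    then show ?thesis by simp
  qed
  have st: "0 < \<sigma> * \<theta>" using s t pi_gt_zero by (intro mult_pos_pos) linarith+
  have cos: "cos (\<sigma> * \<theta>) > 0"
    using st t by (intro cos_gt_zero_pi) auto
  have [measurable]: "q \<theta> \<in> borel_measurable borel" for \<theta> by (simp add: q_def)
  have "(\<lambda>n. integral\<^sup>L halfline (q (T n))) \<longlonglongrightarrow> integral\<^sup>L halfline (q (pi / 2))"
  proof (rule integral_dominated_convergence)
    show "integrable halfline (\<lambda>r. exp (- (y * cos (\<sigma> * \<theta>)) * r powr \<sigma>))"
      using y cos s by (intro integrable_exp_powr) auto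
    show "AE r in halfline. (\<lambda>n. q (T n) r) \<longlonglongrightarrow> q (pi / 2) r"
      unfolding q_def cis_conv_exp by (intro AE_halflineI tendsto_intros Tlim)
    fix n
    show "AE r in halfline. norm (q (T n) r) \<le> exp (- (y * cos (\<sigma> * \<theta>)) * r powr \<sigma>)"
    proof (rule AE_halflineI)
      fix r :: real assume r: "r > 0"
      have "cos (T n) < 0" using T[of n] t by (intro cos_lt_zero_pi) auto
      then have "cos (T n) * r \<le> 0" using r by (simp add: mult_nonpos_nonneg)
      moreover have "cos (\<sigma> * \<theta>) \<le> cos (\<sigma> * T n)"
        using T[of n] t s st pi_gt_zero
        by (intro cos_monotone_0_pi_le mult_left_mono mult_nonneg_nonneg) linarith+
      then have "(y * r powr \<sigma>) * cos (\<sigma> * \<theta>) \<le> (y * r powr \<sigma>) * cos (\<sigma> * T n)"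
        using y by (intro mult_left_mono) auto
      ultimately have "cos (T n) * r - (y * r powr \<sigma>) * cos (\<sigma> * T n) \<le> - (y * cos (\<sigma> * \<theta>)) * r powr \<sigma>"
        by (simp add: mult_ac)
      then show "norm (q (T n) r) \<le> exp (- (y * cos (\<sigma> * \<theta>)) * r powr \<sigma>)"
        unfolding q_def norm_ray_exp by simp
    qed
  qed simp_all
  then have "(\<lambda>n. Im (integral\<^sup>L halfline (q (T n))) / pi) \<longlonglongrightarrow> Im (integral\<^sup>L halfline (q (pi / 2))) / pi"
    by (intro tendsto_intros) auto
  moreover have "Im (integral\<^sup>L halfline (q (T n))) / pi = reduced_wright (- \<sigma>) (- y)" for n
    unfolding q_def using T[of n] t s by (intro reduced_wright_ray [symmetric]) auto
  ultimately have "reduced_wright (- \<sigma>) (- y) = Im (integral\<^sup>L halfline (q (pi / 2))) / pi"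
    by (simp add: LIMSEQ_const_iff)
  \<comment> \<open>The prefactor cis (pi/2) = i turns the imaginary part into a real part.\<close>
  also have "q (pi / 2) = (\<lambda>r. \<i> * (exp (\<i> * of_real r) * exp (- of_real (y * r powr \<sigma>) * cis (\<sigma> * (pi / 2)))))"
    by (simp add: q_def mult_ac)
  finally show ?thesis by simp
qed

text \<open>For \<open>x = 1\<close> this is the density of the one-sided \<open>\<sigma>\<close>-stable law.\<close>

definition stable_density :: "real \<Rightarrow> real \<Rightarrow> real \<Rightarrow> real" where
  "stable_density \<sigma> x s = reduced_wright (- \<sigma>) (- (x * s powr (- \<sigma>))) / s"

lemma borel_measurable_stable_density [measurable]:
  "stable_density \<sigma> x \<in> borel_measurable borel"
  unfolding stable_density_def [abs_def] by measurable

lemma cexp_powr_imag: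
  assumes "r > 0"
  shows "cexp_powr x \<sigma> (\<i> * of_real r) = exp (- of_real (x * r powr \<sigma>) * cis (\<sigma> * (pi / 2)))"
    and "cexp_powr x \<sigma> (\<i> * of_real (- r)) = cnj (cexp_powr x \<sigma> (\<i> * of_real r))"
proof -
  have 1: "(\<i> * of_real r) powr of_real \<sigma> = of_real (r powr \<sigma>) * cis (\<sigma> * (pi / 2))"
    using powr_of_real_cis[OF assms, of "pi / 2"] by (simp add: mult.commute)
  then show "cexp_powr x \<sigma> (\<i> * of_real r) = exp (- of_real (x * r powr \<sigma>) * cis (\<sigma> * (pi / 2)))"
    by (simp add: cexp_powr_def mult_ac)
  have "- pi < - (pi / 2)" "- (pi / 2) \<le> pi" using pi_gt_zero by linarith+
  moreover have "cis (- (pi / 2)) = - \<i>" by (simp add: complex_eq_iff)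
  ultimately have 2: "(\<i> * of_real (- r)) powr of_real \<sigma> = of_real (r powr \<sigma>) * cis (\<sigma> * (- (pi / 2)))"
    using powr_of_real_cis[OF assms, of "- (pi / 2)"] by (simp add: mult.commute)
  show "cexp_powr x \<sigma> (\<i> * of_real (- r)) = cnj (cexp_powr x \<sigma> (\<i> * of_real r))"
    unfolding cexp_powr_def 1 2 by (simp add: exp_cnj cis_cnj)
qed

text \<open>Scaling r by t turns x t^(- \<sigma>) r^\<sigma> into x r^\<sigma>, and its Jacobian
  cancels the 1/t in the density. Conjugate symmetry of the integrand then makes twice the real part
  an integral over the whole axis.\<close>

lemma stable_density_fourier:
  assumes s: "0 < \<sigma>" "\<sigma> < 1" and x: "x > 0" and t: "t > 0"
  shows "of_real (stable_density \<sigma> x t) =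
     (LINT y|lborel. exp (\<i> * of_real (t * y)) * cexp_powr x \<sigma> (\<i> * of_real y)) / (2 * pi)"
proof -
  note [measurable] = borel_measurable_cexp_powr_imag[OF s(1)]
  define F where "F = (\<lambda>y. exp (\<i> * of_real (t * y)) * cexp_powr x \<sigma> (\<i> * of_real y))"
  have [measurable]: "F \<in> borel_measurable borel" unfolding F_def by measurable
  have [measurable]: "cnj \<in> borel_measurable borel"
    by (intro borel_measurable_continuous_onI continuous_intros)
  define y where "y = x * t powr (- \<sigma>)"
  have y: "y > 0" using x t by (simp add: y_def)
  define G where "G = (\<lambda>r. exp (\<i> * of_real r) * exp (- of_real (y * r powr \<sigma>) * cis (\<sigma> * (pi / 2))))"
  have [measurable]: "G \<in> borel_measurable borel" by (simp add: G_def)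
  have "reduced_wright (- \<sigma>) (- y) = Re (integral\<^sup>L halfline G) / pi"
    unfolding G_def by (rule reduced_wright_imag_axis[OF s y])
  also have "integral\<^sup>L halfline G = t *\<^sub>R integral\<^sup>L halfline (\<lambda>r. G (t * r))"
    by (rule integral_halfline_scale) (use t in auto)
  also have "integral\<^sup>L halfline (\<lambda>r. G (t * r)) = integral\<^sup>L halfline F"
  proof (intro integral_cong_AE AE_halflineI)
    fix r :: real assume r: "r > 0"
    have "y * (t * r) powr \<sigma> = x * r powr \<sigma>"
      using r t by (simp add: y_def powr_mult powr_minus field_simps)
    then show "G (t * r) = F r"
      unfolding G_def F_def cexp_powr_imag(1)[OF r] by simp
  qed simp_all
  finally have *: "stable_density \<sigma> x t = Re (integral\<^sup>L halfline F) / pi"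
    using t by (simp add: stable_density_def y_def)
  have Fneg: "F (- r) = cnj (F r)" if "r > 0" for r
    using cexp_powr_imag(2)[OF that, of x \<sigma>] by (simp add: F_def exp_cnj)
  have Fi: "integrable lborel F"
    by (rule Bochner_Integration.integrable_bound[OF integrable_cexp_powr_imag[OF s x]])
       (auto simp: F_def norm_mult)
  have Fh: "integrable halfline F"
    using Fi unfolding integrable_halfline_iff[OF \<open>F \<in> borel_measurable borel\<close>] set_integrable_def
    by (intro integrable_mult_indicator) auto
  have Fnh: "integrable halfline (\<lambda>r. F (- r)) \<longleftrightarrow> integrable halfline (\<lambda>r. cnj (F r))"
    by (intro integrable_cong_AE AE_halflineI) (auto simp: Fneg)
  have "integral\<^sup>L lborel F = integral\<^sup>L halfline F + integral\<^sup>L halfline (\<lambda>r. F (- r))"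
    using Fh Fnh by (intro integral_lborel_halfline) auto
  also have "integral\<^sup>L halfline (\<lambda>r. F (- r)) = integral\<^sup>L halfline (\<lambda>r. cnj (F r))"
    by (intro integral_cong_AE AE_halflineI) (auto simp: Fneg)
  also have "\<dots> = cnj (integral\<^sup>L halfline F)" by simp
  also have "integral\<^sup>L halfline F + \<dots> = of_real (2 * Re (integral\<^sup>L halfline F))"
    by (rule complex_add_cnj)
  finally show ?thesis unfolding * F_def [symmetric] by simp
qed

section \<open>Bounds on the reduced Wright function and integrability of the density\<close>

lemma norm_exp_minus_one_le:
  assumes "Re w \<le> 0"
  shows "norm (exp w - 1 :: complex) \<le> norm w"
proof -
  \<comment> \<open>The derivative of exp has norm at most 1 on the convex left half-plane.\<close>
  have "norm (exp w - exp 0) \<le> 1 * norm (w - 0)"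
    by (rule field_differentiable_bound[where S = "{w. Re w \<le> 0}" and f' = exp])
       (use assms in \<open>auto intro!: derivative_eq_intros convex_halfspace_Re_le\<close>)
  then show ?thesis by simp
qed

lemma reduced_wright_bounds:
  assumes s: "0 < \<sigma>" "\<sigma> < 1"
  obtains C where "\<And>y. y \<ge> 0 \<Longrightarrow> \<bar>reduced_wright (- \<sigma>) (- y)\<bar> \<le> C"
    and "\<And>y. y \<ge> 0 \<Longrightarrow> \<bar>reduced_wright (- \<sigma>) (- y)\<bar> \<le> C * y"
proof -
  obtain \<theta> where t: "pi / 2 < \<theta>" "\<theta> < pi" "\<sigma> * \<theta> < pi / 2" using exists_ray_angle[OF s] .
  have st: "0 < \<sigma> * \<theta>" using s t pi_gt_zero by (intro mult_pos_pos) linarith+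
  have cos: "cos (\<sigma> * \<theta>) > 0"
    using st t by (intro cos_gt_zero_pi) auto
  have c: "- cos \<theta> > 0" using cos_lt_zero_pi[of \<theta>] t by auto
  define q where "q = (\<lambda>y r. cis \<theta> * exp (of_real r * cis \<theta>) * exp (- of_real (y * r powr \<sigma>) * cis (\<sigma> * \<theta>)))"
  have [measurable]: "q y \<in> borel_measurable borel" for y by (simp add: q_def)
  define w0 where "w0 = (\<lambda>r. exp (- (- cos \<theta>) * r))"
  define w1 where "w1 = (\<lambda>r. r powr ((1 + \<sigma>) - 1) * exp (- (- cos \<theta>) * r))"
  have w0: "integrable halfline w0" unfolding w0_def by (rule integrable_halfline_exp[OF c])
  have w1: "integrable halfline w1" unfolding w1_def using s c by (intro Gamma_halfline(1)) auto
  have q0: "norm (q y r) \<le> w0 r" if "y \<ge> 0" for y r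
    unfolding q_def norm_ray_exp w0_def using that cos by simp
  have qi: "integrable halfline (q y)" if "y \<ge> 0" for y
    by (rule integrable_halfline_bound[OF w0]) (use q0 that in auto)
  have rep: "reduced_wright (- \<sigma>) (- y) = Im (integral\<^sup>L halfline (q y)) / pi" for y
    unfolding q_def by (rule reduced_wright_ray[OF s t(1,2)])
  have le0: "\<bar>reduced_wright (- \<sigma>) (- y)\<bar> \<le> integral\<^sup>L halfline w0 / pi" if "y \<ge> 0" for y
  proof -
    have "\<bar>Im (integral\<^sup>L halfline (q y))\<bar> \<le> norm (integral\<^sup>L halfline (q y))" by (rule abs_Im_le_cmod)
    also have "\<dots> \<le> integral\<^sup>L halfline w0"
      by (rule Bochner_Integration.integral_norm_bound_integral[OF qi w0]) (use that q0 in auto)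
    finally show ?thesis unfolding rep by (simp add: divide_right_mono)
  qed
  have le1: "\<bar>reduced_wright (- \<sigma>) (- y)\<bar> \<le> y * integral\<^sup>L halfline w1 / pi" if y: "y \<ge> 0" for y
  proof -
    \<comment> \<open>The ray integral at y = 0 has no imaginary part, so it can be subtracted for
      free; exp z - 1 is then of the order of z, which is linear in y.\<close>
    have "reduced_wright (- \<sigma>) (- 0) = 0" by (simp add: reduced_wright_def)
    then have "Im (integral\<^sup>L halfline (q 0)) = 0" using rep[of 0] by simp
    then have "\<bar>Im (integral\<^sup>L halfline (q y))\<bar> = \<bar>Im (integral\<^sup>L halfline (\<lambda>r. q y r - q 0 r))\<bar>"
      using qi y by (subst Bochner_Integration.integral_diff) auto
    also have "\<dots> \<le> norm (integral\<^sup>L halfline (\<lambda>r. q y r - q 0 r))" by (rule abs_Im_le_cmod)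
    also have "\<dots> \<le> integral\<^sup>L halfline (\<lambda>r. y * w1 r)"
    proof (rule Bochner_Integration.integral_norm_bound_integral)
      fix r
      define z where "z = - of_real (y * r powr \<sigma>) * cis (\<sigma> * \<theta>)"
      have "q y r - q 0 r = cis \<theta> * exp (of_real r * cis \<theta>) * (exp z - 1)"
        by (simp add: q_def z_def algebra_simps)
      then have "norm (q y r - q 0 r) = exp (cos \<theta> * r) * norm (exp z - 1)"
        by (simp add: norm_mult mult.commute)
      also have "\<dots> \<le> exp (cos \<theta> * r) * norm z"
        using y cos by (intro mult_left_mono norm_exp_minus_one_le) (auto simp: z_def)
      also have "norm z = y * r powr \<sigma>" using y by (simp add: z_def norm_mult)
      finally show "norm (q y r - q 0 r) \<le> y * w1 r" by (simp add: w1_def mult_ac)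
    qed (use qi y w1 in auto)
    also have "\<dots> = y * integral\<^sup>L halfline w1" by simp
    finally show ?thesis unfolding rep by (simp add: divide_right_mono)
  qed
  define C where "C = max (integral\<^sup>L halfline w0 / pi) (integral\<^sup>L halfline w1 / pi)"
  show ?thesis
  proof (rule that)
    fix y :: real assume y: "y \<ge> 0"
    show "\<bar>reduced_wright (- \<sigma>) (- y)\<bar> \<le> C" using le0[OF y] by (simp add: C_def)
    have "y * (integral\<^sup>L halfline w1 / pi) \<le> y * C" using y by (intro mult_left_mono) (auto simp: C_def)
    then show "\<bar>reduced_wright (- \<sigma>) (- y)\<bar> \<le> C * y" using le1[OF y] by (simp add: mult_ac)
  qed
qed

text \<open>Supplies the s-integrability for the final Fubini step.\<close>

lemma integrable_stable_density:
  assumes s: "0 < \<sigma>" "\<sigma> < 1" and x: "x > 0"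
  shows "integrable halfline (stable_density \<sigma> x)"
proof -
  obtain C where C: "\<And>y. y \<ge> 0 \<Longrightarrow> \<bar>reduced_wright (- \<sigma>) (- y)\<bar> \<le> C * y"
    using reduced_wright_bounds[OF s] by blast
  define K where "K = (LINT y|lborel. norm (cexp_powr x \<sigma> (\<i> * of_real y))) / (2 * pi)"
  show ?thesis
  proof (rule integrable_halfline_powr_tail[where q = "1 + \<sigma>" and C = K and D = "C * x"])
    \<comment> \<open>The Fourier integral controls \<open>t \<rightarrow> 0\<close>; the linear bound at argument 0 controls \<open>t \<rightarrow> \<infinity>\<close>.\<close>
    fix t :: real assume t: "0 < t"
    have "norm (stable_density \<sigma> x t) = norm (complex_of_real (stable_density \<sigma> x t))" by simp
    also have "\<dots> \<le> K"
      unfolding stable_density_fourier[OF s x t] K_def norm_divide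
      by (intro divide_mono integral_norm_bound[THEN order_trans]) (auto simp: norm_mult)
    finally show "norm (stable_density \<sigma> x t) \<le> K" .
  next
    fix t :: real assume t: "t \<ge> 1"
    have "norm (stable_density \<sigma> x t) \<le> C * (x * t powr - \<sigma>) / t"
      unfolding stable_density_def using t x by (auto intro!: divide_right_mono C)
    also have "\<dots> = C * x * t powr (- (1 + \<sigma>))"
      using t by (simp add: powr_diff powr_minus field_simps powr_add)
    finally show "norm (stable_density \<sigma> x t) \<le> C * x * t powr (- (1 + \<sigma>))" .
  qed (use s in auto)
qed

subsection \<open>Laplace transform and subordination\<close>

text \<open>In the Fourier integral the modulus of the double integrand is the product exp (- Re p
  t) |g y|, so Fubini applies; the t-integral is 1 / (p - i y), and Cauchy's formula evaluates the
  rest.\<close>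

lemma laplace_stable_density:
  assumes s: "0 < \<sigma>" "\<sigma> < 1" and x: "x > 0" and p: "Re p > 0"
  shows "integral\<^sup>L halfline (\<lambda>t. exp (- p * of_real t) * of_real (stable_density \<sigma> x t)) = cexp_powr x \<sigma> p"
proof -
  note [measurable] = borel_measurable_cexp_powr_imag[OF s(1)]
  interpret pair_sigma_finite halfline lborel ..
  define g where "g = (\<lambda>y. cexp_powr x \<sigma> (\<i> * of_real y))"
  have g: "integrable lborel g" unfolding g_def by (rule integrable_cexp_powr_imag[OF s x])
  have [measurable]: "g \<in> borel_measurable borel" unfolding g_def by measurable
  define f where "f = (\<lambda>t y. exp (- (p - \<i> * of_real y) * of_real t) * g y)"
  have nf: "norm (f t y) = exp (- Re p * t) * norm (g y)" for t y
    by (simp add: f_def norm_mult)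
  have fm: "case_prod f \<in> borel_measurable (halfline \<Otimes>\<^sub>M lborel)"
    unfolding f_def by measurable
  have fi: "integrable lborel (f t)" for t
    by (rule Bochner_Integration.integrable_bound[of _ "\<lambda>y. exp (- Re p * t) * norm (g y)"])
      (use g fm in \<open>simp_all add: nf\<close>)
  have "integrable (halfline \<Otimes>\<^sub>M lborel) (case_prod f)"
  proof (rule Fubini_integrable)
    show "integrable halfline (\<lambda>t. LINT y|lborel. norm (case_prod f (t, y)))"
      using integrable_halfline_exp[OF p] by (simp add: nf)
  qed (use fm fi in auto)
  then have "(LINT y|lborel. integral\<^sup>L halfline (\<lambda>t. f t y)) = integral\<^sup>L halfline (\<lambda>t. LINT y|lborel. f t y)"
    by (rule Fubini_integral)
  also have "\<dots> = integral\<^sup>L halfline (\<lambda>t. (2 * pi) * (exp (- p * of_real t) * of_real (stable_density \<sigma> x t)))"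
  proof (intro integral_cong_AE AE_halflineI)
    fix t :: real assume t: "t > 0"
    have "(LINT y|lborel. f t y) = (LINT y|lborel. exp (- p * of_real t) * (exp (\<i> * of_real (t * y)) * g y))"
      by (intro Bochner_Integration.integral_cong) (simp_all add: f_def exp_add [symmetric] algebra_simps)
    also have "\<dots> = exp (- p * of_real t) * (LINT y|lborel. exp (\<i> * of_real (t * y)) * g y)"
      by (rule integral_mult_right_zero)
    also have "(LINT y|lborel. exp (\<i> * of_real (t * y)) * g y) = (2 * pi) * of_real (stable_density \<sigma> x t)"
      using stable_density_fourier[OF s x t] by (simp add: g_def)
    finally show "(LINT y|lborel. f t y) = (2 * pi) * (exp (- p * of_real t) * of_real (stable_density \<sigma> x t))"
      by (simp add: mult_ac)
  qed (use fm in \<open>simp_all add: lborel.borel_measurable_lebesgue_integral\<close>)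
  also have "\<dots> = (2 * pi) * integral\<^sup>L halfline (\<lambda>t. exp (- p * of_real t) * of_real (stable_density \<sigma> x t))"
    by (rule integral_mult_right_zero)
  also have "(LINT y|lborel. integral\<^sup>L halfline (\<lambda>t. f t y)) = (LINT y|lborel. g y / (p - \<i> * of_real y))"
  proof (intro Bochner_Integration.integral_cong refl)
    fix y
    have "integral\<^sup>L halfline (\<lambda>t. of_real (t powr (1 - 1)) * exp (- (p - \<i> * of_real y) * of_real t)) =
       inverse (p - \<i> * of_real y)"
      using p by (subst Gamma_halfline_complex) (auto simp: powr_minus)
    also have "integral\<^sup>L halfline (\<lambda>t. of_real (t powr (1 - 1)) * exp (- (p - \<i> * of_real y) * of_real t)) =
       integral\<^sup>L halfline (\<lambda>t. exp (- (p - \<i> * of_real y) * of_real t))"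
      by (intro integral_cong_AE AE_halflineI) auto
    finally show "integral\<^sup>L halfline (\<lambda>t. f t y) = g y / (p - \<i> * of_real y)"
      unfolding f_def by (subst integral_mult_left_zero) (simp add: divide_inverse)
  qed
  also have "\<dots> = 2 * pi * cexp_powr x \<sigma> p"
    unfolding g_def by (rule cauchy_cexp_powr_imag[OF s x p])
  finally show ?thesis by simp
qed

theorem theorem3:
  fixes \<sigma>1 \<sigma>2 x :: real
  assumes "0 < \<sigma>1" "\<sigma>1 < 1"
    and "0 < \<sigma>2" "\<sigma>2 < 1"
    and "x > 0"
  shows "set_integrable lborel {0<..}
           (\<lambda>s. reduced_wright (- \<sigma>1) (- s)
              * reduced_wright (- \<sigma>2) (- (x * s powr (- \<sigma>2))) / s)
       \<and> reduced_wright (- (\<sigma>1 * \<sigma>2)) (- x)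
         = (LBINT s:{0<..}. reduced_wright (- \<sigma>1) (- s)
              * reduced_wright (- \<sigma>2) (- (x * s powr (- \<sigma>2))) / s)"
proof -
  note s1 = assms(1,2) and s2 = assms(3,4) and x = assms(5)
  obtain \<theta> where t: "pi / 2 < \<theta>" "\<theta> < pi" "\<sigma>1 * \<theta> < pi / 2" using exists_ray_angle[OF s1] .
  have st: "0 < \<sigma>1 * \<theta>" using s1 t pi_gt_zero by (intro mult_pos_pos) linarith+
  have cos: "cos (\<sigma>1 * \<theta>) > 0"
    using st t by (intro cos_gt_zero_pi) auto
  have c: "- cos \<theta> > 0" using cos_lt_zero_pi[of \<theta>] t by auto
  interpret pair_sigma_finite halfline halfline ..
  define D where "D = stable_density \<sigma>2 x"
  have D: "integrable halfline D" unfolding D_def by (rule integrable_stable_density[OF s2 x])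
  have [measurable]: "D \<in> borel_measurable borel" unfolding D_def by measurable
  define q where "q = (\<lambda>s r. cis \<theta> * exp (of_real r * cis \<theta>) * exp (- of_real (s * r powr \<sigma>1) * cis (\<sigma>1 * \<theta>)))"
  \<comment> \<open>By \<sigma>1 \<theta> < pi/2 the factor containing s has modulus at most 1, so
    the bound does not depend on s > 0.\<close>
  have q0: "norm (q s r) \<le> exp (- (- cos \<theta>) * r)" if "s > 0" for s r
    unfolding q_def norm_ray_exp using that cos by simp
  have w: "integrable halfline (\<lambda>r. exp (- (- cos \<theta>) * r))" by (rule integrable_halfline_exp[OF c])
  define f where "f = (\<lambda>s r. q s r * of_real (D s))"
  have fm: "case_prod f \<in> borel_measurable (halfline \<Otimes>\<^sub>M halfline)"
    unfolding f_def q_def by measurable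
  have fint: "integrable (halfline \<Otimes>\<^sub>M halfline) (case_prod f)"
  proof (rule Bochner_Integration.integrable_bound)
    show "integrable (halfline \<Otimes>\<^sub>M halfline) (\<lambda>(s, r). \<bar>D s\<bar> * exp (- (- cos \<theta>) * r))"
    proof (rule Fubini_integrable)
      show "integrable halfline (\<lambda>s. LINT r|halfline. norm (case (s, r) of (s, r) \<Rightarrow> \<bar>D s\<bar> * exp (- (- cos \<theta>) * r)))"
        using D by (simp add: abs_mult)
    qed (use w in simp_all)
    have m: "{z \<in> space (halfline \<Otimes>\<^sub>M halfline). 0 < fst z} \<in> sets (halfline \<Otimes>\<^sub>M halfline)"
      by measurable
    \<comment> \<open>The bound on \<open>q\<close> needs s > 0, which is transferred to almost
      every point of the product through its sections.\<close>
    have "AE s in halfline. AE r in halfline. 0 < s"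
      by (auto intro!: AE_halflineI)
    then have "AE z in halfline \<Otimes>\<^sub>M halfline. fst z > 0"
      using AE_pair_iff[of "\<lambda>s r. 0 < s", OF m] by simp
    then show "AE z in halfline \<Otimes>\<^sub>M halfline. norm (case_prod f z) \<le>
        norm (case z of (s, r) \<Rightarrow> \<bar>D s\<bar> * exp (- (- cos \<theta>) * r))"
      by eventually_elim
        (use q0 in \<open>auto simp: f_def norm_mult abs_mult mult.commute intro!: mult_left_mono\<close>)
  qed (rule fm)
  \<comment> \<open>Holds for every real s, because the ray formula has no sign condition; hence it
    may be used to rewrite whole functions.\<close>
  have h_eq: "reduced_wright (- \<sigma>1) (- s) * D s = Im (LINT r|halfline. f s r) / pi" for s
    unfolding f_def q_def by (subst integral_mult_left_zero)
      (simp add: reduced_wright_ray[OF s1 t(1,2)])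
  have h_int: "integrable halfline (\<lambda>s. reduced_wright (- \<sigma>1) (- s) * D s)"
    unfolding h_eq using integrable_fst[OF fint] by simp
  have h_form: "(\<lambda>s. reduced_wright (- \<sigma>1) (- s) * D s) = (\<lambda>s. reduced_wright (- \<sigma>1) (- s)
              * reduced_wright (- \<sigma>2) (- (x * s powr (- \<sigma>2))) / s)"
    by (simp add: D_def stable_density_def)
  have inner: "integral\<^sup>L halfline (\<lambda>s. f s r) = cis \<theta> * exp (of_real r * cis \<theta>) *
      exp (- of_real (x * r powr (\<sigma>1 * \<sigma>2)) * cis (\<sigma>1 * \<sigma>2 * \<theta>))" if r: "r > 0" for r
  proof -
    define p where "p = of_real (r powr \<sigma>1) * cis (\<sigma>1 * \<theta>)"
    have "Re p > 0" using r cos by (simp add: p_def)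
    have "integral\<^sup>L halfline (\<lambda>s. f s r) = integral\<^sup>L halfline (\<lambda>s. (cis \<theta> * exp (of_real r * cis \<theta>)) *
       (exp (- p * of_real s) * of_real (D s)))"
      by (intro Bochner_Integration.integral_cong refl) (simp add: f_def q_def p_def mult_ac)
    also have "\<dots> = (cis \<theta> * exp (of_real r * cis \<theta>)) * cexp_powr x \<sigma>2 p"
      unfolding D_def by (subst integral_mult_right_zero, subst laplace_stable_density[OF s2 x \<open>Re p > 0\<close>]) simp
    \<comment> \<open>0 < \<sigma>1 \<theta> < pi/2 is the principal argument of p, so the iterated
      power u^\<sigma>1, then ^\<sigma>2, crosses no branch cut and equals u^(\<sigma>1
      \<sigma>2).\<close>
    also have "p powr of_real \<sigma>2 = of_real (r powr (\<sigma>1 * \<sigma>2)) * cis (\<sigma>1 * \<sigma>2 * \<theta>)"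
      unfolding p_def using r st t
      by (subst powr_of_real_cis) (auto simp: powr_powr mult_ac)
    then have "cexp_powr x \<sigma>2 p = exp (- of_real (x * r powr (\<sigma>1 * \<sigma>2)) * cis (\<sigma>1 * \<sigma>2 * \<theta>))"
      by (simp add: cexp_powr_def mult_ac)
    finally show ?thesis .
  qed
  have s12: "0 < \<sigma>1 * \<sigma>2" "\<sigma>1 * \<sigma>2 < 1"
    using s1 s2 mult_strict_mono[of \<sigma>1 1 \<sigma>2 1] by auto
  have "integral\<^sup>L halfline (\<lambda>s. reduced_wright (- \<sigma>1) (- s) * D s) = Im (LINT s|halfline. LINT r|halfline. f s r) / pi"
    unfolding h_eq using integrable_fst[OF fint] by simp
  also have "(LINT s|halfline. LINT r|halfline. f s r) = (LINT r|halfline. LINT s|halfline. f s r)"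
    by (rule Fubini_integral[OF fint, symmetric])
  also have "\<dots> = integral\<^sup>L halfline (\<lambda>r. cis \<theta> * exp (of_real r * cis \<theta>) *
      exp (- of_real (x * r powr (\<sigma>1 * \<sigma>2)) * cis (\<sigma>1 * \<sigma>2 * \<theta>)))"
    using integrable_snd[OF fint, THEN borel_measurable_integrable]
    by (intro integral_cong_AE AE_halflineI inner) auto
  also have "Im \<dots> / pi = reduced_wright (- (\<sigma>1 * \<sigma>2)) (- x)"
    by (rule reduced_wright_ray[OF s12 t(1,2), symmetric])
  finally have "reduced_wright (- (\<sigma>1 * \<sigma>2)) (- x) = integral\<^sup>L halfline (\<lambda>s. reduced_wright (- \<sigma>1) (- s) * D s)" ..
  then show ?thesis
    using h_int by (simp add: integrable_halfline_iff integral_halfline flip: h_form)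
qed

end
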